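(* Let $m \geq 1$ and $n = 2m$. Consider the labeled chip-firing process on $\mathbb{Z}$ started from $\Delta^n$, the configuration with chips $(1),(2),\ldots,(n)$ all at vertex $0$. Suppose $\Delta^n \to \mathcal{D}$ where $\mathcal{D}$ is stable. Then for all $1 \leq k \leq m$ we have $\mathcal{D}(k) = -(m+1)+k$ and $\mathcal{D}(m+k) = k$. (In particular, the stable configuration reachable from $\Delta^n$ is unique and the chips appear in increasing order of label from left to right.)
   Context: Labeled chip-firing on the infinite path $\mathbb{Z}$ (vertices $\mathbb{Z}$, $i$ adjacent to $i\pm1$): a labeled configuration is a function $\mathcal{C}\colon X \to \mathbb{Z}$ for a finite set $X \subseteq \mathbb{Z}_{>0}$ of labels, chip $(i)$ being at vertex $\mathcal{C}(i)$. A labeled chip-firing move: if chips $(a)$ and $(b)$ with $a<b$ are at the same vertex $i$, move $(a)$ to $i-1$ and $(b)$ to $i+1$. We write $\mathcal{C} \to \mathcal{D}$ if $\mathcal{D}$ is obtained from $\mathcal{C}$ by a sequence of zero or more such moves. $\mathcal{D}$ is stable if no vertex holds two or more chips. *)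

theory Defs
  imports Main
begin

text \<open>
  A labeled configuration \<open>C : X \<rightarrow> \<int>\<close> is a partial map whose domain is the label set \<open>X\<close>;
  \<open>C a = Some v\<close> says that chip \<open>(a)\<close> is at vertex \<open>v\<close>. Labels are positive naturals.
\<close>

type_synonym config = "nat \<rightharpoonup> int"

definition labeled_config :: "config \<Rightarrow> bool" where
  "labeled_config C \<longleftrightarrow> finite (dom C) \<and> (\<forall>a \<in> dom C. 0 < a)"

inductive fires :: "config \<Rightarrow> config \<Rightarrow> bool" (infix "\<leadsto>" 50) where
  fire: "labeled_config C \<Longrightarrow> a < b \<Longrightarrow> C a = Some i \<Longrightarrow> C b = Some i
    \<Longrightarrow> C \<leadsto> C(a \<mapsto> i - 1, b \<mapsto> i + 1)"

abbreviation reaches :: "config \<Rightarrow> config \<Rightarrow> bool" (infix "\<leadsto>*" 50) where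
  "C \<leadsto>* D \<equiv> fires\<^sup>*\<^sup>* C D"

definition stable :: "config \<Rightarrow> bool" where
  "stable C \<longleftrightarrow> \<not> (\<exists>v a b. a \<noteq> b \<and> C a = Some v \<and> C b = Some v)"

definition Delta :: "nat \<Rightarrow> config" where
  "Delta n = (\<lambda>a. if a \<in> {1..n} then Some 0 else None)"

lemma labeled_config_Delta: "labeled_config (Delta n)"
  by (auto simp: labeled_config_def Delta_def dom_def)

lemma labeled_config_fires:
  assumes "C \<leadsto> D"
  shows "labeled_config D"
  using assms
proof cases
  case (fire a b i)
  then have "dom D = dom C"
    by (auto simp: dom_fun_upd)
  with fire show ?thesis
    by (simp add: labeled_config_def)
qed

end

theory Submission
  imports Defs
begin

text \<open>
  Let \<open>\<rho> i\<close> be the number of times vertex \<open>i\<close> still has to fire; initially it is the triangular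
  number of \<open>m - \<bar>i\<bar>\<close>, and it vanishes exactly on stable configurations. The last \<open>m - \<bar>i\<bar>\<close>
  firings of the vertices \<open>i\<close> interlace like the crossings of \<open>m\<close> right-going wires with \<open>m\<close>
  left-going wires, and each of them leaves its vertex empty. The \<open>b\<close>-th left-going wire
  (\<open>0 \<le> b < m\<close>) ends at \<open>b - m\<close>. Every chip whose next crossing involves wire \<open>b\<close> has label
  greater than \<open>b\<close>: of the two chips at that crossing, the larger one has label greater than
  \<open>b + 1\<close> and passes on to wire \<open>b + 1\<close>, and the smaller one stays on wire \<open>b\<close>. Hence the chip
  ending at \<open>b - m\<close> has label greater than \<open>b\<close> and chips ending on the right have labels
  greater than \<open>m\<close>, which sorts the left half. The right half follows by reflection.
\<close>

section \<open>Occupation numbers\<close>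

definition occ :: "config \<Rightarrow> int \<Rightarrow> int" where
  "occ C i = int (card {a. C a = Some i})"

lemma finite_chips: "finite (dom C) \<Longrightarrow> finite {a. C a = Some i}"
  by (rule finite_subset[of _ "dom C"]) auto

lemma occ_nonneg: "0 \<le> occ C i"
  by (simp add: occ_def)

lemma occ_pos: "finite (dom C) \<Longrightarrow> C a = Some i \<Longrightarrow> 0 < occ C i"
  using finite_chips[of C i] by (auto simp: occ_def card_gt_0_iff)

lemma occ_stable:
  assumes "stable C"
  shows "occ C i \<le> 1"
proof -
  have "a = b" if "C a = Some i" "C b = Some i" for a b
    using assms that unfolding stable_def by blast
  then have "card {a. C a = Some i} \<le> Suc 0"
    by (intro card_le_Suc0_iff_eq[THEN iffD2] ballI)
      (auto intro: card_ge_0_finite finite_subset[of _ "{SOME a. C a = Some i}"] someI2)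
  then show ?thesis
    by (simp add: occ_def)
qed

lemma occ_move:
  assumes "finite (dom C)" "C a = Some v"
  shows "occ (C(a \<mapsto> w)) i = occ C i - of_bool (i = v) + of_bool (i = w)"
proof -
  let ?S = "{x. C x = Some i}"
  have fin: "finite ?S"
    using assms(1) by (rule finite_chips)
  have "{x. (C(a \<mapsto> w)) x = Some i} = (if i = w then insert a (?S - {a}) else ?S - {a})"
    by auto
  moreover have "int (card (?S - {a})) = int (card ?S) - of_bool (i = v)"
  proof (cases "i = v")
    case True
    then have "a \<in> ?S"
      using assms(2) by simp
    with fin have "card ?S = Suc (card (?S - {a}))"
      by (rule card.remove)
    with True show ?thesis
      by simp
  next
    case False
    then have "?S - {a} = ?S"
      using assms(2) by auto
    with False show ?thesis
      by simp
  qed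
  moreover have "card (insert a (?S - {a})) = Suc (card (?S - {a}))"
    using fin by (simp del: insert_Diff_single)
  ultimately show ?thesis
    unfolding occ_def by (cases "i = w") (simp_all del: fun_upd_apply insert_Diff_single)
qed

lemma occ_fire:
  assumes "finite (dom C)" "a \<noteq> b" "C a = Some v" "C b = Some v"
  shows "occ (C(a \<mapsto> v - 1, b \<mapsto> v + 1)) i =
    occ C i - 2 * of_bool (i = v) + of_bool (i = v - 1) + of_bool (i = v + 1)"
  using occ_move[of "C(a \<mapsto> v - 1)" b v "v + 1" i] occ_move[of C a v "v - 1" i] assms
  by simp

lemma dom_fires: "C \<leadsto> D \<Longrightarrow> dom D = dom C"
  by (induction rule: fires.induct) (simp add: dom_fun_upd insert_absorb domI del: fun_upd_apply)

section \<open>The invariant and the initial configuration\<close>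

definition final :: "nat \<Rightarrow> int \<Rightarrow> int" where
  "final m i = of_bool (i \<noteq> 0 \<and> \<bar>i\<bar> \<le> int m)"

text \<open>
  Here \<open>x\<close> and \<open>y\<close> are the remaining firings at the vertices of absolute value \<open>i\<close> and \<open>i + 1\<close>
  on one side of the origin. The two clauses say that the \<open>r\<close>-th last firing of the outer vertex
  lies between the \<open>r\<close>-th last and the \<open>(r + 1)\<close>-st last firing of the inner one.
\<close>

definition interlaced :: "nat \<Rightarrow> int \<Rightarrow> int \<Rightarrow> int \<Rightarrow> bool" where
  "interlaced m i x y \<longleftrightarrow>
    (x < int m - i \<longrightarrow> y \<le> x) \<and> (y < int m - (i + 1) \<longrightarrow> x \<le> y + 1)"

text \<open>In the last conjunct, \<open>m - \<rho> i - max 0 (- i)\<close> numbers the left-going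
  wire in the next crossing at \<open>i\<close> once at most \<open>m - |i|\<close> firings remain
  there. Before that, \<open>i + 1 \<le> k\<close> and positivity of labels already imply the second
  bound.\<close>

definition invariant :: "nat \<Rightarrow> config \<Rightarrow> (int \<Rightarrow> int) \<Rightarrow> bool" where
  "invariant m C \<rho> \<longleftrightarrow>
    dom C = {1..2 * m} \<and>
    (\<forall>i. 0 \<le> \<rho> i) \<and> (\<forall>i. int m \<le> \<bar>i\<bar> \<longrightarrow> \<rho> i = 0) \<and>
    (\<forall>i. occ C i = final m i + 2 * \<rho> i - \<rho> (i - 1) - \<rho> (i + 1)) \<and>
    (\<forall>i\<ge>0. interlaced m i (\<rho> i) (\<rho> (i + 1)) \<and> interlaced m i (\<rho> (- i)) (\<rho> (- i - 1))) \<and>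
    (\<forall>k i. C k = Some i \<longrightarrow> i + 1 \<le> int k \<and> int m + 1 - \<rho> i - max 0 (- i) \<le> int k)"

lemma invariant_Delta: "\<exists>\<rho>. invariant m (Delta (2 * m)) \<rho>"
proof -
  define T :: "int \<Rightarrow> int" where "T j = j * (j + 1) div 2" for j
  have T_Suc: "T (j + 1) = T j + j + 1" for j
  proof -
    have "(j + 1) * (j + 1 + 1) = j * (j + 1) + (j + 1) * 2"
      by (simp add: algebra_simps)
    then show ?thesis
      unfolding T_def by simp
  qed
  have T0: "T 0 = 0"
    by (simp add: T_def)
  have T_ge: "j \<le> T j" if "0 \<le> j" for j
    using that by (induction j rule: int_ge_induct) (simp_all add: T0 T_Suc)
  define \<rho> where "\<rho> i = T (max 0 (int m - \<bar>i\<bar>))" for i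
  \<comment> \<open>This makes the premises of both clauses of \<open>interlaced\<close> false, and
    makes the initial label bound at most 1.\<close>
  have \<rho>_ge: "int m - \<bar>i\<bar> \<le> \<rho> i" "0 \<le> \<rho> i" for i
    using T_ge[of "max 0 (int m - \<bar>i\<bar>)"] by (auto simp: \<rho>_def)
  have \<rho>_0: "\<rho> i = 0" if "int m \<le> \<bar>i\<bar>" for i
    using that by (simp add: \<rho>_def T0)
  have \<rho>_step: "\<rho> i = \<rho> j + (int m - \<bar>i\<bar>)" if "\<bar>j\<bar> = \<bar>i\<bar> + 1" "\<bar>i\<bar> < int m" for i j
    using T_Suc[of "int m - \<bar>j\<bar>"] that by (simp add: \<rho>_def)
  have occ_Delta: "occ (Delta (2 * m)) i = (if i = 0 then 2 * int m else 0)" for i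
  proof -
    have "{a. Delta (2 * m) a = Some i} = (if i = 0 then {1..2 * m} else {})"
      by (auto simp: Delta_def split: if_splits)
    then show ?thesis
      by (simp add: occ_def)
  qed
  \<comment> \<open>For 0 < |i| \<le> m the second difference of \<open>\<rho>\<close> cancels
    \<open>final\<close>; at the origin \<open>\<rho>\<close> drops by \<open>m\<close> on either
    side, leaving \<open>2 * m\<close> chips.\<close>
  have "occ (Delta (2 * m)) i = final m i + 2 * \<rho> i - \<rho> (i - 1) - \<rho> (i + 1)" for i
  proof -
    consider "i = 0" "m = 0" | "i = 0" "0 < m" | "i \<noteq> 0" "\<bar>i\<bar> < int m"
      | "i \<noteq> 0" "\<bar>i\<bar> = int m" | "int m < \<bar>i\<bar>"
      by fastforce
    then show ?thesis
    proof cases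
      case 1
      then show ?thesis
        using occ_Delta[of 0] by (simp add: final_def \<rho>_0)
    next
      case 2
      then show ?thesis
        using \<rho>_step[of 1 0] \<rho>_step[of "- 1" 0] by (simp add: occ_Delta final_def)
    next
      case 3
      show ?thesis
      proof (cases "0 < i")
        case True
        then show ?thesis
          using 3 \<rho>_step[of "i + 1" i] \<rho>_step[of i "i - 1"] by (simp add: occ_Delta final_def)
      next
        case False
        then show ?thesis
          using 3 \<rho>_step[of "i - 1" i] \<rho>_step[of i "i + 1"] by (simp add: occ_Delta final_def)
      qed
    next
      case 4
      show ?thesis
      proof (cases "0 < i")
        case True
        then show ?thesis
          using 4 \<rho>_0[of "i + 1"] \<rho>_0[of i] \<rho>_step[of i "i - 1"]
          by (simp add: occ_Delta final_def)
      next
        case False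
        then show ?thesis
          using 4 \<rho>_0[of "i - 1"] \<rho>_0[of i] \<rho>_step[of i "i + 1"]
          by (simp add: occ_Delta final_def)
      qed
    qed (auto simp: occ_Delta final_def \<rho>_0)
  qed
  moreover have "interlaced m i (\<rho> i) (\<rho> (i + 1)) \<and> interlaced m i (\<rho> (- i)) (\<rho> (- i - 1))"
    if "0 \<le> i" for i
    using that \<rho>_ge(1)[of i] \<rho>_ge(1)[of "i + 1"] \<rho>_ge(1)[of "- i"] \<rho>_ge(1)[of "- i - 1"]
    by (simp add: interlaced_def)
  moreover have "dom (Delta (2 * m)) = {1..2 * m}"
    by (auto simp: Delta_def split: if_splits)
  moreover have "i + 1 \<le> int k \<and> int m + 1 - \<rho> i - max 0 (- i) \<le> int k"
    if "Delta (2 * m) k = Some i" for k i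
    using that \<rho>_ge(1)[of 0] by (auto simp: Delta_def split: if_splits)
  ultimately show ?thesis
    unfolding invariant_def using \<rho>_ge \<rho>_0 by blast
qed

section \<open>Preservation under firing\<close>

text \<open>If one neighbour had too many firings left for its tightened clause, the sum bound would
  leave the other too few for its old clause.\<close>

lemma interlaced_fire:
  assumes "interlaced m (i - 1) x r" "interlaced m i r y" "x + y \<le> 2 * r - 1"
  shows "interlaced m (i - 1) x (r - 1) \<and> interlaced m i (r - 1) y"
  using assms unfolding interlaced_def by auto

text \<open>\<open>final\<close> vanishes at the origin, hence 2 in place of 1, and both neighbours
  are outer ones.\<close>

lemma interlaced_fire_0:
  assumes "interlaced m 0 r x" "interlaced m 0 r y" "x + y \<le> 2 * r - 2"
  shows "interlaced m 0 (r - 1) x \<and> interlaced m 0 (r - 1) y"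
  using assms unfolding interlaced_def by auto

lemma invariant_fires:
  assumes inv: "invariant m C \<rho>" and "C \<leadsto> D"
  shows "\<exists>\<rho>'. invariant m D \<rho>'"
  using assms(2)
proof cases
  case (fire a b v)
  note D = fire(1)
  define \<rho>' where "\<rho>' = \<rho>(v := \<rho> v - 1)"
  have dom: "dom C = {1..2 * m}" and nonneg: "\<And>i. 0 \<le> \<rho> i"
    and outside: "\<And>i. int m \<le> \<bar>i\<bar> \<Longrightarrow> \<rho> i = 0"
    and occ: "\<And>i. occ C i = final m i + 2 * \<rho> i - \<rho> (i - 1) - \<rho> (i + 1)"
    and right: "\<And>i. 0 \<le> i \<Longrightarrow> interlaced m i (\<rho> i) (\<rho> (i + 1))"
    and left: "\<And>i. 0 \<le> i \<Longrightarrow> interlaced m i (\<rho> (- i)) (\<rho> (- i - 1))"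
    and label: "\<And>k i. C k = Some i \<Longrightarrow>
      i + 1 \<le> int k \<and> int m + 1 - \<rho> i - max 0 (- i) \<le> int k"
    using inv unfolding invariant_def by auto
  have fin: "finite (dom C)"
    by (simp add: dom)
  have right': "interlaced m (v - 1) (\<rho> (v - 1)) (\<rho> v)" if "0 < v"
    using right[of "v - 1"] that by simp
  have left': "interlaced m (- v) (\<rho> v) (\<rho> (v - 1))" if "v \<le> 0"
    using left[of "- v"] that by simp
  have left'': "interlaced m (- v - 1) (\<rho> (v + 1)) (\<rho> v)" if "v < 0"
    using left[of "- v - 1"] that by (simp add: algebra_simps)
  have occ_D: "occ D i =
      occ C i - 2 * of_bool (i = v) + of_bool (i = v - 1) + of_bool (i = v + 1)" for i
    unfolding D using fin fire by (intro occ_fire) auto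
  have occ': "occ D i = final m i + 2 * \<rho>' i - \<rho>' (i - 1) - \<rho>' (i + 1)" for i
    using occ_D[of i] occ[of i] by (auto simp: \<rho>'_def)
  have occ_v: "occ D v = final m v + 2 * (\<rho> v - 1) - \<rho> (v - 1) - \<rho> (v + 1)"
    using occ'[of v] by (simp add: \<rho>'_def)
  \<comment> \<open>Legality of the firing enters here: \<open>v\<close> cannot be left with a
    negative number of chips.\<close>
  have nbrs: "\<rho> (v - 1) + \<rho> (v + 1) \<le> final m v + 2 * \<rho> v - 2"
    using occ_v occ_nonneg[of D v] by simp
  have \<rho>_v: "1 \<le> \<rho> v"
    using nbrs nonneg[of "v - 1"] nonneg[of "v + 1"] by (auto simp: final_def of_bool_def split: if_splits)
  then have v: "\<bar>v\<bar> < int m"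
    using outside[of v] by (cases "\<bar>v\<bar> < int m") auto

  have edges: "interlaced m i (\<rho>' i) (\<rho>' (i + 1)) \<and> interlaced m i (\<rho>' (- i)) (\<rho>' (- i - 1))"
    if i: "0 \<le> i" for i
  proof -
    consider "v = 0" | "0 < v" | "v < 0"
      by linarith
    then show ?thesis
    proof cases
      case 1
      have "interlaced m 0 (\<rho> 0 - 1) (\<rho> 1) \<and> interlaced m 0 (\<rho> 0 - 1) (\<rho> (- 1))"
        using interlaced_fire_0[of m "\<rho> 0" "\<rho> 1" "\<rho> (- 1)"] nbrs 1 right[of 0] left[of 0]
        by (simp add: final_def)
      then show ?thesis
        using 1 i right[of i] left[of i] by (cases "i = 0") (auto simp: \<rho>'_def)
    next
      case 2
      have "interlaced m (v - 1) (\<rho> (v - 1)) (\<rho> v - 1) \<and> interlaced m v (\<rho> v - 1) (\<rho> (v + 1))"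
        using interlaced_fire[of m v "\<rho> (v - 1)" "\<rho> v" "\<rho> (v + 1)"] nbrs 2 v
          right[of v] right' by (simp add: final_def)
      moreover have "i = v - 1" if "i + 1 = v"
        using that by simp
      ultimately show ?thesis
        using 2 i right[of i] left[of i] by (auto simp: \<rho>'_def)
    next
      case 3
      have "interlaced m (- v - 1) (\<rho> (v + 1)) (\<rho> v - 1) \<and> interlaced m (- v) (\<rho> v - 1) (\<rho> (v - 1))"
        using interlaced_fire[of m "- v" "\<rho> (v + 1)" "\<rho> v" "\<rho> (v - 1)"] nbrs 3 v
          left' left'' by (simp add: final_def)
      moreover have "i = - v - 1" if "- i - 1 = v"
        using that by simp
      ultimately show ?thesis
        using 3 i right[of i] left[of i] by (auto simp: \<rho>'_def)
    qed
  qed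

  \<comment> \<open>Interlacing bounds the neighbours from below: at least
    \<open>\<rho> v - 1\<close> firings remain at an outer one and \<open>\<rho> v\<close> at an
    inner one.\<close>
  have emptied: "occ D v = 0" if late: "\<rho> v \<le> int m - \<bar>v\<bar>"
  proof -
    have "final m v + 2 * (\<rho> v - 1) \<le> \<rho> (v - 1) + \<rho> (v + 1)"
    proof -
      consider "v = 0" | "0 < v" | "v < 0"
        by linarith
      then show ?thesis
      proof cases
        case 1
        then show ?thesis
          using right[of v] left' late by (auto simp: final_def interlaced_def)
      next
        case 2
        then show ?thesis
          using right[of v] right' late v by (auto simp: final_def interlaced_def)
      next
        case 3
        then show ?thesis
          using left' left'' late v by (auto simp: final_def interlaced_def)
      qed
    qed
    then show ?thesis
      using occ_v occ_nonneg[of D v] by simp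
  qed

  have label_ab: "v + 1 \<le> int a" "int m + 1 - \<rho> v - max 0 (- v) \<le> int a" "int a + 1 \<le> int b"
    using label[of a v] fire by auto
  have a_pos: "1 \<le> int a"
    using domI[of C a v] fire dom by simp
  have label_D: "i + 1 \<le> int k \<and> int m + 1 - \<rho>' i - max 0 (- i) \<le> int k"
    if k: "D k = Some i" for k i
  proof -
    consider "k = a" "i = v - 1" | "k = b" "i = v + 1" | "i = v" "k \<noteq> a" "k \<noteq> b" "C k = Some v"
      | "i \<noteq> v" "C k = Some i"
      using k[unfolded D] fire(5) by (cases "k = b"; cases "k = a"; cases "i = v") auto
    then show ?thesis
    proof cases
      \<comment> \<open>Chip \<open>a\<close> keeps its wire number if the clause of
        \<open>interlaced\<close> applies; otherwise the bound at \<open>v - 1\<close> is at most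
        \<open>max 1 v\<close>.\<close>
      case 1
      show ?thesis
      proof (cases "0 < v")
        case True
        then show ?thesis
          using 1 label_ab right' by (auto simp: \<rho>'_def interlaced_def)
      next
        case False
        then show ?thesis
          using 1 label_ab a_pos left' by (auto simp: \<rho>'_def interlaced_def)
      qed
    next
      \<comment> \<open>Here the wire number may rise by one, which \<open>a + 1 \<le> b\<close>
        pays for.\<close>
      case 2
      show ?thesis
      proof (cases "0 \<le> v")
        case True
        then show ?thesis
          using 2 label_ab right[of v] by (auto simp: \<rho>'_def interlaced_def)
      next
        case False
        then show ?thesis
          using 2 label_ab a_pos left'' by (auto simp: \<rho>'_def interlaced_def)
      qed
    next
      \<comment> \<open>A chip left behind shows that \<open>v\<close> was not emptied, so more than
        \<open>m - |v|\<close> firings remained; even the raised bound is then at most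
        \<open>max 1 (v + 1)\<close>.\<close>
      case 3
      have "0 < occ D v"
        using k 3 fin by (intro occ_pos[of D k]) (auto simp: D)
      then have "int m - \<bar>v\<bar> < \<rho> v"
        using emptied by linarith
      moreover have "1 \<le> int k"
        using domI[of C k v] 3 dom by simp
      ultimately show ?thesis
        using 3 label[of k v] by (auto simp: \<rho>'_def)
    next
      case 4
      then show ?thesis
        using label[of k i] by (simp add: \<rho>'_def)
    qed
  qed

  have dom_D: "dom D = {1..2 * m}"
    using dom_fires assms(2) dom by simp
  have bounds: "0 \<le> \<rho>' i" "int m \<le> \<bar>i\<bar> \<Longrightarrow> \<rho>' i = 0" for i
    using nonneg[of i] outside[of i] \<rho>_v v by (auto simp: \<rho>'_def)
  have "invariant m D \<rho>'"
    unfolding invariant_def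
    by (intro conjI allI impI)
      (simp_all only: dom_D bounds edges occ' label_D[THEN conjunct1] label_D[THEN conjunct2])
  then show ?thesis
    by (rule exI[of _ \<rho>'])
qed

lemma invariant_reaches: "Delta (2 * m) \<leadsto>* D \<Longrightarrow> \<exists>\<rho>. invariant m D \<rho>"
proof (induction rule: rtranclp_induct)
  case base
  show ?case
    by (rule invariant_Delta)
next
  case (step C D)
  then obtain \<rho> where "invariant m C \<rho>"
    by auto
  with step.hyps(2) show ?case
    by (intro invariant_fires)
qed

section \<open>Stable configurations have no firings left\<close>

text \<open>Convexity carries a strict descent one step to the left, so the induction runs on the
  distance to the zero at \<open>m\<close>.\<close>

lemma convex_decreasing:
  fixes g :: "nat \<Rightarrow> int"
  assumes convex: "\<And>i. 0 < i \<Longrightarrow> i < m \<Longrightarrow> 2 * g i \<le> g (i - 1) + g (i + 1)"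
    and nonneg: "\<And>i. 0 \<le> g i" and zero: "g m = 0"
  shows "i < m \<Longrightarrow> 0 < g i \<or> 0 < g (i + 1) \<Longrightarrow> g (i + 1) < g i"
proof (induction "m - i" arbitrary: i)
  case (Suc d)
  show ?case
  proof (cases "0 < g (i + 1)")
    case True
    then have "i + 1 < m"
      using Suc.prems zero by (cases "i + 1 = m") auto
    then have "g (i + 1 + 1) < g (i + 1)"
      using Suc True by (intro Suc.hyps(1)) auto
    then show ?thesis
      using convex[of "i + 1"] \<open>i + 1 < m\<close> by simp
  next
    case False
    then show ?thesis
      using Suc.prems nonneg[of "i + 1"] by linarith
  qed
qed simp

lemma convex_zero:
  fixes g :: "nat \<Rightarrow> int"
  assumes convex: "\<And>i. 0 < i \<Longrightarrow> i < m \<Longrightarrow> 2 * g i \<le> g (i - 1) + g (i + 1)"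
    and nonneg: "\<And>i. 0 \<le> g i" and zero: "g m = 0" and g_0: "g 0 = 0"
  shows "i \<le> m \<Longrightarrow> g i = 0"
proof (induction i)
  case (Suc i)
  then show ?case
    using convex_decreasing[of m g i, OF convex nonneg zero] nonneg[of "i + 1"] by fastforce
qed (simp add: g_0)

text \<open>With at most one chip per vertex, \<open>\<rho>\<close> is convex on each side between
  the origin and distance \<open>m\<close>. If \<open>\<rho> 0\<close> were positive, it would fall
  by at least 1 on both sides, while stability at the origin allows a total fall of only 1.\<close>

lemma invariant_stable:
  assumes inv: "invariant m D \<rho>" and "stable D"
  shows "\<rho> i = 0"
proof -
  have nonneg: "\<And>i. 0 \<le> \<rho> i"
    and outside: "\<And>i. int m \<le> \<bar>i\<bar> \<Longrightarrow> \<rho> i = 0"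
    and occ: "\<And>i. occ D i = final m i + 2 * \<rho> i - \<rho> (i - 1) - \<rho> (i + 1)"
    using inv unfolding invariant_def by auto
  have le: "final m i + 2 * \<rho> i \<le> \<rho> (i - 1) + \<rho> (i + 1) + 1" for i
    using occ[of i] occ_stable[OF assms(2), of i] by simp
  define g h where "g j = \<rho> (int j)" and "h j = \<rho> (- int j)" for j
  have h_nbrs: "h (j - 1) = \<rho> (- int j + 1)" "h (j + 1) = \<rho> (- int j - 1)" if "0 < j" for j
    unfolding h_def using that by (auto intro!: arg_cong[of _ _ \<rho>])
  have g: "2 * g j \<le> g (j - 1) + g (j + 1)" and h: "2 * h j \<le> h (j - 1) + h (j + 1)"
    if "0 < j" "j < m" for j
    using that le[of "int j"] le[of "- int j"]
      h_nbrs[of j]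
    by (simp_all add: g_def h_def[of j] final_def of_nat_diff add.commute)
  have g': "0 \<le> g j" "g m = 0" and h': "0 \<le> h j" "h m = 0" for j
    by (simp_all add: g_def h_def nonneg outside)
  have "\<rho> 0 = 0"
  proof (rule ccontr)
    assume "\<rho> 0 \<noteq> 0"
    then have pos: "0 < \<rho> 0" and "0 < m"
      using nonneg[of 0] outside[of 0] by (auto intro: Nat.gr0I)
    have "g (0 + 1) < g 0"
      by (rule convex_decreasing[of m g, OF g g'(1,2)]) (use pos \<open>0 < m\<close> in \<open>auto simp: g_def\<close>)
    moreover have "h (0 + 1) < h 0"
      by (rule convex_decreasing[of m h, OF h h'(1,2)]) (use pos \<open>0 < m\<close> in \<open>auto simp: h_def\<close>)
    ultimately show False
      using le[of 0] by (simp add: g_def h_def final_def)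
  qed
  then have "g j = 0" "h j = 0" if "j \<le> m" for j
    using convex_zero[of m g j, OF g g'(1,2)] convex_zero[of m h j, OF h h'(1,2)] that
    by (simp_all add: g_def h_def)
  from this[of "nat \<bar>i\<bar>"] outside[of i] show ?thesis
    by (cases "int m \<le> \<bar>i\<bar>"; cases "0 \<le> i") (auto simp: g_def h_def)
qed

section \<open>The left half\<close>

text \<open>Once \<open>\<rho>\<close> vanishes, the label bound keeps chip \<open>k\<close> from
  lying right of \<open>k - m - 1\<close>; the vertices left of that are taken by smaller
  labels.\<close>

lemma left_half_sorted:
  assumes "Delta (2 * m) \<leadsto>* D" "stable D"
  shows "1 \<le> k \<Longrightarrow> k \<le> m \<Longrightarrow> D k = Some (int k - int m - 1)"
proof (induction k rule: less_induct)
  case (less k)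
  obtain \<rho> where inv: "invariant m D \<rho>"
    using invariant_reaches assms(1) by blast
  have \<rho>: "\<rho> i = 0" for i
    using invariant_stable[OF inv assms(2)] .
  have dom: "dom D = {1..2 * m}" and occ: "\<And>i. occ D i = final m i"
    and label: "\<And>k i. D k = Some i \<Longrightarrow> int m + 1 - max 0 (- i) \<le> int k"
    using inv unfolding invariant_def by (auto simp: \<rho>)
  have "k \<in> dom D"
    using less.prems dom by auto
  then obtain i where i: "D k = Some i"
    by auto
  have "0 < final m i"
    using occ_pos[of D k i] i occ[of i] dom by simp
  then have "- int m \<le> i" "i \<le> int k - int m - 1"
    using label[OF i] less.prems by (auto simp: final_def split: if_splits)
  moreover have "\<not> i < int k - int m - 1"
  proof
    assume lt: "i < int k - int m - 1"
    \<comment> \<open>The label that the induction hypothesis places at \<open>i\<close>.\<close>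
    define l where "l = nat (i + int m + 1)"
    have l: "1 \<le> l" "l < k" "int l - int m - 1 = i"
      using lt \<open>- int m \<le> i\<close> by (auto simp: l_def)
    then have "D l = Some i"
      using less.IH[of l] less.prems by simp
    then show False
      using assms(2) i l(2) unfolding stable_def by (metis less_irrefl)
  qed
  ultimately show ?case
    using i by simp
qed

section \<open>Reflection and the right half\<close>

text \<open>Negating vertices alone would send the smaller chip right; reversing the labels as well
  restores the firing rule.\<close>

definition reflect :: "nat \<Rightarrow> config \<Rightarrow> config" where
  "reflect n C k = (if k \<in> {1..n} then map_option uminus (C (n + 1 - k)) else None)"

lemma reflect_Delta: "reflect n (Delta n) = Delta n"
  by (auto simp: reflect_def Delta_def fun_eq_iff)

lemma reflect_fires:
  assumes "C \<leadsto> D" "dom C \<subseteq> {1..n}"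
  shows "reflect n C \<leadsto> reflect n D"
  using assms(1)
proof cases
  case (fire a b v)
  have ab: "a \<in> {1..n}" "b \<in> {1..n}"
    using fire assms(2) by auto
  have "dom (reflect n C) \<subseteq> {1..n}"
    by (auto simp: reflect_def split: if_splits)
  then have "labeled_config (reflect n C)"
    unfolding labeled_config_def by (auto intro: finite_subset)
  \<comment> \<open>The chips trade roles: the image of \<open>b\<close> is now the smaller label
    and moves left.\<close>
  moreover have "reflect n D = (reflect n C)(n + 1 - b \<mapsto> - v - 1, n + 1 - a \<mapsto> - v + 1)"
    using ab fire by (auto simp: reflect_def fun_eq_iff)
  moreover have "reflect n C (n + 1 - b) = Some (- v)" "reflect n C (n + 1 - a) = Some (- v)"
    using ab fire by (auto simp: reflect_def)
  moreover have "n + 1 - b < n + 1 - a"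
    using ab fire by auto
  ultimately show ?thesis
    by (metis fires.fire)
qed

lemma dom_reaches: "Delta n \<leadsto>* D \<Longrightarrow> dom D = {1..n}"
proof (induction rule: rtranclp_induct)
  case base
  then show ?case
    by (auto simp: Delta_def split: if_splits)
next
  case (step C D)
  then show ?case
    by (simp add: dom_fires)
qed

lemma reflect_reaches: "Delta n \<leadsto>* D \<Longrightarrow> Delta n \<leadsto>* reflect n D"
proof (induction rule: rtranclp_induct)
  case base
  then show ?case
    by (simp add: reflect_Delta)
next
  case (step C D)
  then show ?case
    using reflect_fires[of C D n] dom_reaches[of n C] by (auto intro: rtranclp.rtrancl_into_rtrancl)
qed

lemma reflect_stable:
  assumes "stable C"
  shows "stable (reflect n C)"
  unfolding stable_def
proof safe
  fix v a b
  assume *: "a \<noteq> b" "reflect n C a = Some v" "reflect n C b = Some v"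
  then have "n + 1 - a \<noteq> n + 1 - b" "C (n + 1 - a) = Some (- v)" "C (n + 1 - b) = Some (- v)"
    by (auto simp: reflect_def split: if_splits)
  with assms show False
    unfolding stable_def by blast
qed

lemma right_half_sorted:
  assumes "Delta (2 * m) \<leadsto>* D" "stable D" "1 \<le> k" "k \<le> m"
  shows "D (m + k) = Some (int k)"
proof -
  have "reflect (2 * m) D (m + 1 - k) = Some (int (m + 1 - k) - int m - 1)"
    using assms by (intro left_half_sorted reflect_reaches reflect_stable) auto
  moreover have "2 * m + 1 - (m + 1 - k) = m + k"
    using assms by simp
  ultimately show ?thesis
    using assms by (auto simp: reflect_def of_nat_diff split: if_splits)
qed

section \<open>Uniqueness and increasing order\<close>

lemma stable_unique:
  assumes "Delta (2 * m) \<leadsto>* D" "stable D"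
  shows "D k = (if k \<in> {1..m} then Some (int k - int m - 1)
    else if k \<in> {m + 1..2 * m} then Some (int k - int m) else None)"
proof -
  consider "k \<in> {1..m}" | "k \<in> {m + 1..2 * m}" | "k \<notin> {1..2 * m}"
    by fastforce
  then show ?thesis
  proof cases
    case 1
    then show ?thesis
      using left_half_sorted[OF assms] by simp
  next
    case 2
    then show ?thesis
      using right_half_sorted[OF assms, of "k - m"] by (auto simp: of_nat_diff)
  next
    case 3
    then have "k \<notin> dom D"
      using dom_reaches[OF assms(1)] by simp
    then show ?thesis
      using 3 by (auto simp: domIff)
  qed
qed

theorem theorem2p13:
  fixes m n :: nat and D :: config
  assumes "m \<ge> 1" and "n = 2 * m"
    and "Delta n \<leadsto>* D" and "stable D"
  shows "(\<forall>k. 1 \<le> k \<and> k \<le> m \<longrightarrow>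
            D k = Some (- (int m + 1) + int k) \<and> D (m + k) = Some (int k))
       \<and> (\<forall>D'. Delta n \<leadsto>* D' \<and> stable D' \<longrightarrow> D' = D)
       \<and> (\<forall>a b. 1 \<le> a \<and> a < b \<and> b \<le> n \<longrightarrow> the (D a) < the (D b))"
proof -
  \<comment> \<open>The closed form does not mention the configuration, so two reachable stable
    configurations agree everywhere.\<close>
  have D': "D' k = (if k \<in> {1..m} then Some (int k - int m - 1)
      else if k \<in> {m + 1..2 * m} then Some (int k - int m) else None)"
    if "Delta n \<leadsto>* D'" "stable D'" for D' k
    using stable_unique that assms(2) by blast
  note D = D'[OF assms(3,4)]
  have "D' = D" if "Delta n \<leadsto>* D'" "stable D'" for D'
    using D D'[OF that] by (simp add: fun_eq_iff)
  moreover have "the (D a) < the (D b)" if "1 \<le> a" "a < b" "b \<le> n" for a b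
    using that assms(2) by (auto simp: D)
  moreover have "D k = Some (- (int m + 1) + int k)" "D (m + k) = Some (int k)"
    if "1 \<le> k" "k \<le> m" for k
    using that by (simp_all add: D)
  ultimately show ?thesis
    by blast
qed

end
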